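(* Let $A\in(\mathbb{Z}_{\max})^{n\times n}$ and $B\in(\mathbb{Z}_{\max})^{n\times p}$. Then the reachable space $\mathcal{R}_\omega$, i.e. the subsemimodule of $(\mathbb{Z}_{\max})^n$ generated by the columns of all the matrices $B,AB,A^2B,\ldots$ (max-plus matrix products), is a rational semimodule.
   Context: $\mathbb{Z}_{\max}$ is the semiring with set $\mathbb{Z}\cup\{-\infty\}$, addition $\oplus=\max$, multiplication $\otimes=+$; its zero is $\varepsilon=-\infty$ and its unit is $e=0$. Matrix products are taken in this semiring: $(AB)_{ij}=\max_k(A_{ik}+B_{kj})$. The free semimodule $(\mathbb{Z}_{\max})^n$ has entrywise max as addition and action $(\lambda x)_i=\lambda+x_i$. For $G\subset(\mathbb{Z}_{\max})^n$, the subsemimodule generated by $G$ is the set $\mathrm{span}\,G$ of finite linear combinations $\bigoplus_{i=1}^k\lambda_iu^i$ with $u^i\in G$, $\lambda_i\in\mathbb{Z}_{\max}$. ($\mathcal{R}_\omega$ is the set of states $x(k)$, $k$ arbitrary, reachable from $x(0)=\varepsilon$ by the system $x(k)=Ax(k-1)\oplus Bu(k)$ with controls $u(k)\in(\mathbb{Z}_{\max})^p$.) The class of rational subsets of a monoid $(M,\cdot)$ with unit $1_M$ is the least class of subsets of $M$ that contains all finite subsets and is closed under union, product $U\cdot V=\{u\cdot v\mid u\in U,v\in V\}$, and star $U^*=U^0\cup U\cup U^2\cup\cdots$, where $U^0=\{1_M\}$. A subsemimodule $\mathcal{X}\subset(\mathbb{Z}_{\max})^n$ is rational if $\mathcal{X}=\mathrm{span}\,G$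 for some rational subset $G$ of the monoid $((\mathbb{Z}\cup\{-\infty\})^n,+)$ (entrywise addition). *)

theory Defs
  imports "HOL-Analysis.Analysis" "HOL-Library.Set_Algebras"
begin

section \<open>The max-plus semiring of integers\<close>

datatype zmax = MInf | Fin int

instantiation zmax :: linorder
begin

fun less_eq_zmax :: "zmax \<Rightarrow> zmax \<Rightarrow> bool" where
  "MInf \<le> y \<longleftrightarrow> True"
| "Fin a \<le> MInf \<longleftrightarrow> False"
| "Fin a \<le> Fin b \<longleftrightarrow> a \<le> b"

definition less_zmax :: "zmax \<Rightarrow> zmax \<Rightarrow> bool" where
  "x < y \<longleftrightarrow> x \<le> y \<and> \<not> y \<le> (x :: zmax)"

instance
proof
  fix x y z :: zmax
  show "x < y \<longleftrightarrow> x \<le> y \<and> \<not> y \<le> x" by (rule less_zmax_def)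
  show "x \<le> x" by (cases x) auto
  show "x \<le> z" if "x \<le> y" "y \<le> z" using that by (cases x; cases y; cases z) auto
  show "x = y" if "x \<le> y" "y \<le> x" using that by (cases x; cases y) auto
  show "x \<le> y \<or> y \<le> x" by (cases x; cases y) auto
qed

end

text \<open>
  The class operations are the semiring ones: \<open>+\<close> is the maximum, with neutral element
  \<open>0 = -\<infinity>\<close>, and \<open>*\<close> is the addition of integers, with neutral element \<open>1\<close>, the integer zero.
\<close>

instantiation zmax :: comm_semiring_1
begin

definition zero_zmax :: zmax where "0 = MInf"
definition one_zmax :: zmax where "1 = Fin 0"
definition plus_zmax :: "zmax \<Rightarrow> zmax \<Rightarrow> zmax" where "x + y = max x (y :: zmax)"

fun times_zmax :: "zmax \<Rightarrow> zmax \<Rightarrow> zmax" where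
  "Fin a * Fin b = Fin (a + b)"
| "MInf * y = MInf"
| "x * MInf = MInf"

instance
proof
  fix x y z :: zmax
  show "x + y + z = x + (y + z)" by (simp add: plus_zmax_def max.assoc)
  show "x + y = y + x" by (simp add: plus_zmax_def max.commute)
  show "0 + x = x" by (cases x) (auto simp: plus_zmax_def zero_zmax_def max_def)
  show "x * y * z = x * (y * z)" by (cases x; cases y; cases z) auto
  show "x * y = y * x" by (cases x; cases y) auto
  show "1 * x = x" by (cases x) (auto simp: one_zmax_def)
  show "0 * x = 0" by (cases x) (auto simp: zero_zmax_def)
  show "x * 0 = 0" by (cases x) (auto simp: zero_zmax_def)
  show "(0 :: zmax) \<noteq> 1" by (simp add: zero_zmax_def one_zmax_def)
  show "(x + y) * z = x * z + y * z"
    by (cases x; cases y; cases z) (auto simp: plus_zmax_def max_def)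
qed

end

text \<open>
  Consequently, on \<^typ>\<open>zmax ^ 'n\<close> the library's \<open>+\<close>, \<open>*s\<close>, \<open>**\<close> and \<open>*v\<close> are the max-plus
  operations, while the componentwise product \<open>*\<close> (with unit \<open>1\<close>, the vector of integer zeros)
  is the entrywise addition of vectors over the integers extended by \<open>-\<infinity>\<close>.
\<close>

section \<open>Generated subsemimodules\<close>

text \<open>
  The library's span needs a ring of scalars. The empty combination \<open>k = 0\<close> is allowed, so the
  zero vector always belongs to the span.
\<close>

definition semimodule_span :: "('a::comm_semiring_1 ^ 'n) set \<Rightarrow> ('a ^ 'n) set" where
  "semimodule_span G =
     {\<Sum>i<k. c i *s u i | (k :: nat) (c :: nat \<Rightarrow> 'a) u. \<forall>i<k. u i \<in> G}"

section \<open>Rational subsets and rational semimodules\<close>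

text \<open>
  Products and powers of sets are the elementwise ones of \<^theory>\<open>HOL-Library.Set_Algebras\<close>;
  in particular \<open>U ^ 0 = {1}\<close>.
\<close>

inductive rational_subset :: "'m::monoid_mult set \<Rightarrow> bool" where
  finite: "finite U \<Longrightarrow> rational_subset U"
| union: "rational_subset U \<Longrightarrow> rational_subset V \<Longrightarrow> rational_subset (U \<union> V)"
| product: "rational_subset U \<Longrightarrow> rational_subset V \<Longrightarrow> rational_subset (U * V)"
| star: "rational_subset U \<Longrightarrow> rational_subset (\<Union>k. U ^ k)"

definition rational_semimodule :: "(zmax ^ 'n) set \<Rightarrow> bool" where
  "rational_semimodule X \<longleftrightarrow> (\<exists>G. rational_subset G \<and> X = semimodule_span G)"

section \<open>The reachable space\<close>

text \<open>
  The matrix \<open>A\<^sup>k B\<close> is obtained by iterated left multiplication, since \<open>A ^ k\<close> is the entrywise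
  power of a matrix.
\<close>

definition reachable_space :: "zmax ^ 'n ^ 'n \<Rightarrow> zmax ^ 'p ^ 'n \<Rightarrow> (zmax ^ 'n) set" where
  "reachable_space A B = semimodule_span (\<Union>k. columns (((**) A ^^ k) B))"

text \<open>The reachable space consists of the reachable states of the system \<open>x(k) = A x(k-1) + B u(k)\<close>.\<close>

primrec system_state ::
    "zmax ^ 'n ^ 'n \<Rightarrow> zmax ^ 'p ^ 'n \<Rightarrow> (nat \<Rightarrow> zmax ^ 'p) \<Rightarrow> nat \<Rightarrow> zmax ^ 'n" where
  "system_state A B u 0 = 0"
| "system_state A B u (Suc k) = A *v system_state A B u k + B *v u (Suc k)"

lemma semimodule_span_0: "0 \<in> semimodule_span G"
  unfolding semimodule_span_def by (rule CollectI, rule exI[of _ 0]) simp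

lemma semimodule_span_add_scale:
  assumes "x \<in> semimodule_span G" "g \<in> G"
  shows "x + c *s g \<in> semimodule_span G"
proof -
  obtain k :: nat and d u where x: "x = (\<Sum>i<k. d i *s u i)" and u: "\<forall>i<k. u i \<in> G"
    using assms(1) unfolding semimodule_span_def by blast
  have "x + c *s g = (\<Sum>i<Suc k. (d(k := c)) i *s (u(k := g)) i)"
    by (simp add: x)
  moreover have "\<forall>i<Suc k. (u(k := g)) i \<in> G"
    using u assms(2) by (simp add: less_Suc_eq)
  ultimately show ?thesis
    unfolding semimodule_span_def by blast
qed

lemma semimodule_span_least:
  assumes "\<And>x y. x \<in> S \<Longrightarrow> y \<in> S \<Longrightarrow> x + y \<in> S" "0 \<in> S" "\<And>c g. g \<in> G \<Longrightarrow> c *s g \<in> S"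
  shows "semimodule_span G \<subseteq> S"
proof
  fix x assume "x \<in> semimodule_span G"
  then obtain k :: nat and d u where x: "x = (\<Sum>i<k. d i *s u i)" and u: "\<forall>i<k. u i \<in> G"
    unfolding semimodule_span_def by blast
  have "(\<Sum>i<m. d i *s u i) \<in> S" if "m \<le> k" for m
    using that by (induction m) (use assms u in auto)
  then show "x \<in> S" by (simp add: x)
qed

lemma semimodule_span_add_matvec:
  fixes M :: "'a::comm_semiring_1 ^ 'p ^ 'n"
  assumes "x \<in> semimodule_span G" "columns M \<subseteq> G"
  shows "x + M *v w \<in> semimodule_span G"
proof -
  have "x + (\<Sum>j\<in>J. w $ j *s column j M) \<in> semimodule_span G" for J
  proof (induction J rule: infinite_finite_induct)
    case (insert j J)
    have "column j M \<in> G" using assms(2) by (auto simp: columns_def)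
    from semimodule_span_add_scale[OF insert.IH this, of "w $ j"] show ?case
      using insert.hyps by (simp add: ac_simps)
  qed (use assms(1) in auto)
  then show ?thesis by (simp add: matrix_mult_sum)
qed

lemma matvec_scale_axis:
  fixes M :: "'a::comm_semiring_1 ^ 'p ^ 'n"
  shows "M *v (c *s axis j 1) = c *s column j M"
proof -
  have "M $ i $ k * (c * (if k = j then 1 else 0)) = (if k = j then c * M $ i $ k else 0)" for i k
    by (simp add: mult.commute)
  then show ?thesis
    by (simp add: vec_eq_iff matrix_vector_mult_def column_def axis_def)
qed

lemma system_state_eq:
  "system_state A B u k = (\<Sum>i<k. ((**) A ^^ i) B *v u (k - i))"
proof (induction k)
  case (Suc k)
  have "A *v (\<Sum>i<m. f i) = (\<Sum>i<m. A *v f i)" for f and m :: nat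
    by (induction m) (simp_all add: matrix_vector_right_distrib)
  then show ?case
    unfolding sum.lessThan_Suc_shift
    by (simp add: Suc matrix_vector_mul_assoc add.commute)
qed simp

theorem reachable_space_eq_states:
  "reachable_space A B = {system_state A B u k | u k. True}"
proof
  let ?M = "\<lambda>i. ((**) A ^^ i) B"
  show "{system_state A B u k | u k. True} \<subseteq> reachable_space A B"
  proof clarify
    fix u k
    have "(\<Sum>i<m. ?M i *v u (k - i)) \<in> reachable_space A B" for m
    proof (induction m)
      case (Suc m)
      then show ?case
        unfolding reachable_space_def sum.lessThan_Suc
        by (rule semimodule_span_add_matvec) auto
    qed (simp add: reachable_space_def semimodule_span_0)
    then show "system_state A B u k \<in> reachable_space A B"
      by (simp add: system_state_eq)
  qed
  have sum_state: "\<exists>u. (\<Sum>i<k. ?M i *v w i) = system_state A B u k" for k w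
    by (rule exI[of _ "\<lambda>j. w (k - j)"]) (auto simp: system_state_eq intro!: sum.cong)
  have pad: "\<exists>w. system_state A B u k = (\<Sum>i<m. ?M i *v w i)" if "k \<le> m" for u k m
  proof (rule exI[of _ "\<lambda>i. if i < k then u (k - i) else 0"])
    have "(\<Sum>i<k. ?M i *v u (k - i)) = (\<Sum>i<m. ?M i *v (if i < k then u (k - i) else 0))"
      using that by (intro sum.mono_neutral_cong_left) auto
    then show "system_state A B u k = (\<Sum>i<m. ?M i *v (if i < k then u (k - i) else 0))"
      by (simp add: system_state_eq)
  qed
  show "reachable_space A B \<subseteq> {system_state A B u k | u k. True}"
    unfolding reachable_space_def
  proof (rule semimodule_span_least)
    fix x y assume "x \<in> {system_state A B u k | u k. True}" "y \<in> {system_state A B u k | u k. True}"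
    then obtain u k v l where "x = system_state A B u k" "y = system_state A B v l" by blast
    then obtain w1 w2 where "x = (\<Sum>i<max k l. ?M i *v w1 i)" "y = (\<Sum>i<max k l. ?M i *v w2 i)"
      using pad[of k "max k l" u] pad[of l "max k l" v] by auto
    then have "x + y = (\<Sum>i<max k l. ?M i *v (w1 i + w2 i))"
      by (simp add: matrix_vector_right_distrib sum.distrib)
    then show "x + y \<in> {system_state A B u k | u k. True}"
      using sum_state[of "\<lambda>i. w1 i + w2 i" "max k l"] by auto
  next
    have "system_state A B (\<lambda>_. 0) 0 = 0" by simp
    then show "0 \<in> {system_state A B u k | u k. True}" by (metis (mono_tags, lifting) mem_Collect_eq)
  next
    fix c g assume "g \<in> (\<Union>k. columns (?M k))"
    then obtain k j where g: "g = column j (?M k)" by (auto simp: columns_def)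
    have "(\<Sum>i<Suc k. ?M i *v (if i = k then c *s axis j 1 else 0)) = c *s g"
      by (simp add: g matvec_scale_axis)
    then show "c *s g \<in> {system_state A B u k | u k. True}"
      using sum_state[of "\<lambda>i. if i = k then c *s axis j 1 else 0" "Suc k"]
      by (metis (mono_tags, lifting) mem_Collect_eq)
  qed
qed

end

theory Submission
  imports Defs
begin

text \<open>
  For a column \<open>b\<close> of \<open>B\<close>, the generating series \<open>x\<^sub>i\<close> of the entries \<open>(A\<^sup>k b)\<^sub>i\<close> solve the linear
  system \<open>x = b + X A x\<close>. Since power series over the max-plus semiring form a commutative
  idempotent semiring, Gaussian elimination and the star identities \<open>(s + t)\<^sup>* = s\<^sup>* t\<^sup>*\<close> and
  \<open>(u v\<^sup>*)\<^sup>* = 1 + u u\<^sup>* v\<^sup>*\<close> write each \<open>x\<^sub>i\<close> as a finite sum of series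
  \<open>a X\<^sup>m (q X\<^sup>c)\<^sup>*\<close>. On a residue class modulo a common period the summand of greatest slope wins,
  so the coefficients are ultimately geometric there. Hence the columns of the matrices \<open>A\<^sup>k B\<close> form
  a finite union of finite sets and sets \<open>{v} {g}\<^sup>*\<close>, which is itself a rational set.
\<close>

unbundle no vec_syntax
unbundle fps_syntax

section \<open>Rational series over the max-plus semiring\<close>

lemma zmax_add_idem [simp]: "x + x = (x :: zmax)"
  by (simp add: plus_zmax_def)

lemma fps_zmax_add_idem: "x + x = (x :: zmax fps)"
  by (simp add: fps_eq_iff)

lemma fps_zmax_add_left_idem: "x + (x + y) = (x + y :: zmax fps)"
  by (simp add: fps_zmax_add_idem flip: add.assoc)

lemma zmax_add_eq_0_iff: "x + y = 0 \<longleftrightarrow> x = 0 \<and> y = (0 :: zmax)"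
  by (cases x; cases y) (auto simp: plus_zmax_def zero_zmax_def max_def)

text \<open>As \<open>s\<close> has no constant term, coefficient \<open>n\<close> of
  \<open>s * x\<close> involves only coefficients of \<open>x\<close> below \<open>n\<close>. This
  uniqueness replaces cancellation, which fails for max.\<close>

lemma fps_affine_unique:
  fixes s :: "'a::comm_semiring_1 fps"
  assumes "s $ 0 = 0" "x = t + s * x" "y = t + s * y"
  shows "x = y"
proof (rule fps_ext)
  fix n show "x $ n = y $ n"
  proof (induction n rule: less_induct)
    case (less n)
    have "s $ i * x $ (n - i) = s $ i * y $ (n - i)" if "i \<le> n" for i
      using that less assms(1) by (cases "i = 0") auto
    then have "(s * x) $ n = (s * y) $ n"
      by (simp add: fps_mult_nth)
    then show ?case
      using assms(2,3) by (metis fps_add_nth)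
  qed
qed

lemma fps_affine_solution:
  fixes s :: "'a::comm_semiring_1 fps"
  assumes "s $ 0 = 0" "x = t + s * x" "y = 1 + s * y"
  shows "x = y * t"
proof (rule fps_affine_unique[OF assms(1,2)])
  have "y * t = (1 + s * y) * t" by (simp flip: assms(3))
  then show "y * t = t + s * (y * t)" by (simp add: algebra_simps)
qed

section \<open>Monomials and geometric series\<close>

definition fps_monom :: "nat \<Rightarrow> 'a \<Rightarrow> 'a::comm_semiring_1 fps" where
  "fps_monom m a = fps_const a * fps_X ^ m"

text \<open>For \<open>c > 0\<close> this is the star of q X^c. Explicit coefficients replace the
  inverse of 1 - q X^c, since a semiring has no subtraction.\<close>

definition fps_geo :: "nat \<Rightarrow> 'a \<Rightarrow> 'a::comm_semiring_1 fps" where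
  "fps_geo c q = Abs_fps (\<lambda>n. if c dvd n then q ^ (n div c) else 0)"

lemma fps_monom_mult_nth: "(fps_monom m a * f) $ n = (if n < m then 0 else a * f $ (n - m))"
  by (simp add: fps_monom_def mult.assoc fps_X_power_mult_nth)

lemma fps_monom_nth_0: "fps_monom m a $ 0 = (if m = 0 then a else 0)"
  by (simp add: fps_monom_def)

lemma fps_monom_0_right [simp]: "fps_monom m 0 = 0"
  by (simp add: fps_monom_def)

lemma fps_monom_mult_fps_monom: "fps_monom m a * fps_monom k b = fps_monom (m + k) (a * b)"
  by (simp add: fps_monom_def power_add ac_simps flip: fps_const_mult)

lemma fps_monom_power: "fps_monom m a ^ k = fps_monom (m * k) (a ^ k)"
  by (simp add: fps_monom_def power_mult_distrib power_mult)

lemma fps_monom_add: "fps_monom m a + fps_monom m b = fps_monom m (a + b)"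
  by (simp add: fps_monom_def distrib_right flip: fps_const_add)

lemma fps_geo_rec:
  assumes "c > 0"
  shows "fps_geo c q = 1 + fps_monom c q * fps_geo c q"
proof (rule fps_ext)
  fix n
  have "c dvd n \<longleftrightarrow> n = 0" if "n < c" using that assms by (auto dest: nat_dvd_not_less)
  moreover have "n div c = Suc ((n - c) div c)" "c dvd n \<longleftrightarrow> c dvd n - c" "n \<noteq> 0" if "c \<le> n"
    using that assms by (auto simp: le_div_geq dvd_minus_self)
  ultimately show "fps_geo c q $ n = (1 + fps_monom c q * fps_geo c q) $ n"
    by (auto simp: fps_geo_def fps_monom_mult_nth not_less)
qed

text \<open>Splitting exponents by residue modulo \<open>d\<close> writes the star of
  \<open>u\<close> as (1 + u + ... + u^(d-1)) times the star of u^d. Both sides solve y = 1 + u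
  y.\<close>

lemma fps_geo_expand:
  assumes "c > 0" "d > 0"
  shows "fps_geo c q = (\<Sum>k<d. fps_monom c q ^ k) * fps_geo (c * d) (q ^ d)"
proof (rule fps_affine_unique[OF _ fps_geo_rec[OF assms(1)]])
  let ?u = "fps_monom c q" and ?z = "fps_geo (c * d) (q ^ d)"
  show "?u $ 0 = 0" using assms by (simp add: fps_monom_nth_0)
  obtain e where d: "d = Suc e" using assms(2) by (cases d) auto
  let ?P = "\<Sum>k<e. ?u ^ k"
  have z: "?z = 1 + ?u ^ d * ?z"
    using fps_geo_rec[of "c * d" "q ^ d"] assms by (simp add: fps_monom_power)
  have "(\<Sum>k<d. ?u ^ k) = 1 + ?u * ?P"
    unfolding d sum.lessThan_Suc_shift by (simp add: sum_distrib_left)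
  then have "(\<Sum>k<d. ?u ^ k) * ?z = ?z + ?u * ?P * ?z"
    by (simp add: distrib_right)
  also have "\<dots> = 1 + ?u ^ d * ?z + ?u * ?P * ?z"
    by (simp flip: z)
  also have "\<dots> = 1 + ?u * ((\<Sum>k<d. ?u ^ k) * ?z)"
    by (simp add: d algebra_simps)
  finally show "(\<Sum>k<d. ?u ^ k) * ?z = 1 + ?u * ((\<Sum>k<d. ?u ^ k) * ?z)" .
qed

text \<open>
  For \<open>s\<close> without constant term, \<open>y = 1 + s * y\<close> says that \<open>y\<close> is the star of \<open>s\<close>: the solution
  is unique by \<open>fps_affine_unique\<close>.
\<close>

lemma star_add:
  fixes s t :: "zmax fps"
  assumes y: "y = 1 + s * y" and z: "z = 1 + t * z"
  shows "y * z = 1 + (s + t) * (y * z)"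
proof -
  have "y * z = (1 + s * y) * z" by (simp flip: y)
  also have "\<dots> = z + s * y * z" by (simp add: distrib_right)
  also have "\<dots> = 1 + t * z + s * y * (1 + t * z)" by (simp flip: z)
  \<comment> \<open>Idempotency duplicates the cross term \<open>s * y * t * z\<close>, so that both
    \<open>1 + s * y\<close> and \<open>1 + t * z\<close> can be folded back.\<close>
  also have "\<dots> = 1 + s * y * (1 + t * z) + t * (1 + s * y) * z"
    by (simp add: algebra_simps fps_zmax_add_idem fps_zmax_add_left_idem)
  also have "\<dots> = 1 + (s + t) * (y * z)"
    unfolding y[symmetric] z[symmetric] by (simp add: algebra_simps)
  finally show ?thesis .
qed

lemma star_mult_star:
  fixes u v :: "zmax fps"
  assumes w: "w = 1 + u * w" and z: "z = 1 + v * z" and v0: "v $ 0 = 0"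
  shows "1 + u * w * z = 1 + (u * z) * (1 + u * w * z)"
proof -
  \<comment> \<open>By \<open>star_add\<close>, \<open>z * z\<close> is the star of
    \<open>v + v = v\<close>, hence equals \<open>z\<close> by uniqueness.\<close>
  have "z * z = 1 + v * (z * z)"
    using star_add[OF z z] unfolding fps_zmax_add_idem .
  then have zz: "z * z = z" by (rule fps_affine_unique[OF v0 _ z])
  have "u * w * z = u * (1 + u * w) * z" by (simp flip: w)
  also have "\<dots> = u * z + u * u * w * (z * z)" by (simp add: zz algebra_simps)
  finally have "1 + u * w * z = 1 + (u * z + u * u * w * (z * z))" by (rule arg_cong)
  also have "\<dots> = 1 + (u * z) * (1 + u * w * z)" by (simp add: algebra_simps)
  finally show ?thesis .
qed

text \<open>By \<open>star_add\<close> the product is the star of (q + r) X^c, and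
  \<open>q + r\<close> is the maximum \<open>q\<close>.\<close>

lemma fps_geo_mult_geo:
  fixes q r :: zmax
  assumes "c > 0" "r \<le> q"
  shows "fps_geo c q * fps_geo c r = fps_geo c q"
proof (rule fps_affine_unique[OF _ _ fps_geo_rec[OF assms(1)]])
  show "fps_monom c q $ 0 = 0" using assms by (simp add: fps_monom_nth_0)
  have "q + r = q" using assms(2) by (simp add: plus_zmax_def)
  then show "fps_geo c q * fps_geo c r = 1 + fps_monom c q * (fps_geo c q * fps_geo c r)"
    using star_add[OF fps_geo_rec[OF assms(1), of q] fps_geo_rec[OF assms(1), of r]]
    by (simp add: fps_monom_add)
qed

inductive rational_series :: "zmax fps \<Rightarrow> bool" where
  single: "c > 0 \<Longrightarrow> rational_series (fps_monom m a * fps_geo c q)"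
| add: "rational_series x \<Longrightarrow> rational_series y \<Longrightarrow> rational_series (x + y)"

section \<open>Closure properties of rational series\<close>

lemma rational_series_0: "rational_series 0"
  using rational_series.single[of 1 0 0 0] by simp

lemma rational_series_monom: "rational_series (fps_monom m a)"
proof -
  have "fps_geo 1 (0 :: zmax) = 1" by (simp add: fps_geo_def fps_eq_iff power_0_left)
  then show ?thesis using rational_series.single[of 1 m a 0] by simp
qed

lemma rational_series_1: "rational_series 1"
  using rational_series_monom[of 0 1] by (simp add: fps_monom_def)

lemma rational_series_sum:
  "(\<And>i. i \<in> I \<Longrightarrow> rational_series (f i)) \<Longrightarrow> rational_series (sum f I)"
  by (induction I rule: infinite_finite_induct)
    (auto intro: rational_series_0 rational_series.add)

lemma rational_series_monom_mult:
  assumes "rational_series x"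
  shows "rational_series (fps_monom m a * x)"
  using assms
proof induction
  case (single c k b q)
  then show ?case
    using rational_series.single[of c "m + k" "a * b" q]
    by (simp add: fps_monom_mult_fps_monom flip: mult.assoc)
qed (simp add: distrib_left rational_series.add)

text \<open>Expanding both factors to a common period reduces the product to one in which one slope dominates.\<close>

lemma rational_series_geo_mult_geo:
  assumes "c > 0" "d > 0"
  shows "rational_series (fps_geo c q * fps_geo d r)"
proof -
  let ?Q = "fps_geo (c * d) (q ^ d)" and ?R = "fps_geo (c * d) (r ^ c)"
  have "?Q * ?R = fps_geo (c * d) (max (q ^ d) (r ^ c))"
    using assms fps_geo_mult_geo[of "c * d" "r ^ c" "q ^ d"] fps_geo_mult_geo[of "c * d" "q ^ d" "r ^ c"]
    by (cases "q ^ d \<le> r ^ c") (auto simp: max_def mult.commute)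
  then have QR: "rational_series (?Q * ?R)"
    using rational_series.single[of "c * d" 0 1] assms by (simp add: fps_monom_def)
  have "fps_geo c q * fps_geo d r =
      ((\<Sum>k<d. fps_monom c q ^ k) * ?Q) * ((\<Sum>k<c. fps_monom d r ^ k) * ?R)"
    using fps_geo_expand[OF assms, of q] fps_geo_expand[OF assms(2,1), of r] by (simp add: mult.commute)
  also have "\<dots> = (\<Sum>k<d. fps_monom c q ^ k) * (\<Sum>k<c. fps_monom d r ^ k) * (?Q * ?R)"
    by (simp only: ac_simps)
  also have "\<dots> = (\<Sum>k<d. \<Sum>l<c. fps_monom (c * k) (q ^ k) * (fps_monom (d * l) (r ^ l) * (?Q * ?R)))"
    unfolding sum_product unfolding sum_distrib_right
    by (simp add: fps_monom_power mult.assoc)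
  finally show ?thesis
    by (auto intro!: rational_series_sum rational_series_monom_mult QR)
qed

lemma rational_series_mult:
  assumes "rational_series x" "rational_series y"
  shows "rational_series (x * y)"
  using assms(1)
proof induction
  case (single c m a q)
  show ?case using assms(2)
  proof induction
    case (single d k b r)
    have "rational_series (fps_monom m a * (fps_monom k b * (fps_geo c q * fps_geo d r)))"
      by (intro rational_series_monom_mult rational_series_geo_mult_geo single \<open>c > 0\<close>)
    then show ?case by (simp add: ac_simps)
  qed (simp add: distrib_left rational_series.add)
qed (simp add: distrib_right rational_series.add)

text \<open>The star of a sum is a product of stars by \<open>star_add\<close>. For a single term a
  star sits inside a star, which \<open>star_mult_star\<close> resolves with u = a X^m and v = q
  X^c.\<close>

lemma rational_series_star:
  assumes "rational_series s" "s $ 0 = 0"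
  shows "\<exists>y. rational_series y \<and> y = 1 + s * y"
  using assms
proof induction
  case (single c m a q)
  show ?case
  proof (cases "a = 0")
    case True
    then show ?thesis using rational_series_1 by auto
  next
    case False
    \<comment> \<open>For \<open>m = 0\<close> the constant term would be \<open>a\<close>, which is
      nonzero here.\<close>
    then have "m > 0" using single.prems by (cases m) (auto simp: fps_monom_nth_0 fps_geo_def)
    then have w: "fps_geo m a = 1 + fps_monom m a * fps_geo m a" by (rule fps_geo_rec)
    have v0: "fps_monom c q $ 0 = 0" using single.hyps by (simp add: fps_monom_nth_0)
    have "rational_series (1 + fps_monom m a * fps_geo m a * fps_geo c q)"
      unfolding mult.assoc
      by (intro rational_series.add rational_series_1 rational_series_monom_mult
          rational_series_geo_mult_geo single.hyps \<open>m > 0\<close>)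
    then show ?thesis
      using star_mult_star[OF w fps_geo_rec[OF single.hyps] v0] by blast
  qed
next
  case (add s t)
  then have "s $ 0 = 0" "t $ 0 = 0" by (auto simp: zmax_add_eq_0_iff)
  then obtain y z where "rational_series y" "y = 1 + s * y" "rational_series z" "z = 1 + t * z"
    using add.IH by blast
  then show ?case using star_add rational_series_mult by blast
qed

text \<open>Induction on the set of unknowns: the equation for \<open>x m\<close> is solved by the
  star of \<open>a m m\<close> and substituted into the others. The new coefficients still have no
  constant term, so \<open>a\<close> and \<open>b\<close> are generalized.\<close>

lemma rational_series_system:
  fixes a :: "'i \<Rightarrow> 'i \<Rightarrow> zmax fps"
  assumes "finite I"
    and "\<And>i j. i \<in> I \<Longrightarrow> j \<in> I \<Longrightarrow> rational_series (a i j) \<and> a i j $ 0 = 0"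
    and "\<And>i. i \<in> I \<Longrightarrow> rational_series (b i)"
    and "\<And>i. i \<in> I \<Longrightarrow> x i = b i + (\<Sum>j\<in>I. a i j * x j)"
  shows "\<forall>i\<in>I. rational_series (x i)"
  using assms
proof (induction I arbitrary: a b rule: finite_induct)
  case (insert m I)
  note a = insert.prems(1) and b = insert.prems(2) and x = insert.prems(3)
  obtain y where y: "rational_series y" "y = 1 + a m m * y"
    using rational_series_star a by blast
  have xm: "x m = y * (b m + (\<Sum>j\<in>I. a m j * x j))"
    by (rule fps_affine_solution[of "a m m"])
      (use a x[of m] y insert.hyps in \<open>auto simp: ac_simps\<close>)
  have "\<forall>i\<in>I. rational_series (x i)"
  proof (rule insert.IH)
    fix i assume i: "i \<in> I"
    show "rational_series (b i + a i m * y * b m)"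
      using i a b y by (auto intro!: rational_series.add rational_series_mult)
    have "x i = b i + a i m * x m + (\<Sum>j\<in>I. a i j * x j)"
      using i x[of i] insert.hyps by (simp add: ac_simps)
    also have "\<dots> = (b i + a i m * y * b m) + (\<Sum>j\<in>I. (a i j + a i m * y * a m j) * x j)"
      unfolding xm by (simp add: distrib_left distrib_right sum.distrib sum_distrib_left ac_simps)
    finally show "x i = (b i + a i m * y * b m) + (\<Sum>j\<in>I. (a i j + a i m * y * a m j) * x j)" .
  next
    fix i j assume "i \<in> I" "j \<in> I"
    then show "rational_series (a i j + a i m * y * a m j) \<and> (a i j + a i m * y * a m j) $ 0 = 0"
      using a y by (auto intro!: rational_series.add rational_series_mult)
  qed
  moreover from this have "rational_series (x m)"
    unfolding xm using a b y
    by (auto intro!: rational_series.add rational_series_mult rational_series_sum)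
  ultimately show ?case by simp
qed simp

section \<open>Ultimately geometric sequences\<close>

text \<open>The ratio \<open>h\<close> may be \<open>0\<close>, that is minus infinity, which covers
  sequences that eventually vanish.\<close>

definition ult_geometric :: "(nat \<Rightarrow> 'a::comm_semiring_1) \<Rightarrow> bool" where
  "ult_geometric f \<longleftrightarrow> (\<exists>h. \<forall>\<^sub>F j in sequentially. f (Suc j) = h * f j)"

definition periodically_geometric :: "nat \<Rightarrow> (nat \<Rightarrow> 'a::comm_semiring_1) \<Rightarrow> bool" where
  "periodically_geometric N f \<longleftrightarrow> N > 0 \<and> (\<forall>r. ult_geometric (\<lambda>j. f (r + N * j)))"

section \<open>Subsequences and sums of ultimately geometric sequences\<close>

lemma zmax_Fin_power: "Fin a ^ n = Fin (int n * a)"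
  by (induction n) (auto simp: one_zmax_def algebra_simps)

lemma ult_geometric_subseq:
  assumes "ult_geometric f" "M > 0"
  shows "ult_geometric (\<lambda>j. f (M * j))"
proof -
  obtain h J where h: "\<And>j. j \<ge> J \<Longrightarrow> f (Suc j) = h * f j"
    using assms(1) unfolding ult_geometric_def eventually_sequentially by blast
  have *: "f (j + k) = h ^ k * f j" if "j \<ge> J" for j k
    using that by (induction k) (auto simp: h ac_simps)
  have "f (M * Suc j) = h ^ M * f (M * j)" if "j \<ge> J" for j
  proof -
    have "J \<le> M * j" using that assms(2) by (metis One_nat_def Suc_leI le_trans mult_le_mono1 nat_mult_1)
    then show ?thesis using *[of "M * j" M] by (simp add: add.commute)
  qed
  then show ?thesis unfolding ult_geometric_def eventually_sequentially by blast
qed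

text \<open>While finite, both sequences are eventually affine in \<open>j\<close> with slopes
  \<open>p\<close> and \<open>q\<close>. The larger slope finally wins, and equal slopes factor out;
  minus infinity needs separate cases.\<close>

lemma ult_geometric_add_dominant:
  fixes f g :: "nat \<Rightarrow> zmax"
  assumes f: "\<And>j. j \<ge> J \<Longrightarrow> f (Suc j) = p * f j" and g: "\<And>j. j \<ge> J \<Longrightarrow> g (Suc j) = q * g j"
    and "q \<le> p"
  shows "ult_geometric (\<lambda>j. f j + g j)"
proof -
  have fk: "f (J + k) = p ^ k * f J" for k by (induction k) (auto simp: f ac_simps)
  have gk: "g (J + k) = q ^ k * g J" for k by (induction k) (auto simp: g ac_simps)
  have f_ev: ?thesis if "\<exists>K. \<forall>j\<ge>K. f j + g j = f j"
  proof -
    from that obtain K where K: "\<And>j. j \<ge> K \<Longrightarrow> f j + g j = f j" by blast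
    have "f (Suc j) + g (Suc j) = p * (f j + g j)" if "j \<ge> max J K" for j
      using that f[of j] K[of j] K[of "Suc j"] by simp
    then show ?thesis unfolding ult_geometric_def eventually_sequentially by blast
  qed
  show ?thesis
  proof (cases "f J = 0")
    case True
    then have "f j = 0" if "j \<ge> J" for j using fk[of "j - J"] that by simp
    then have "\<forall>j\<ge>J. f (Suc j) + g (Suc j) = q * (f j + g j)" by (simp add: g)
    then show ?thesis unfolding ult_geometric_def eventually_sequentially by blast
  next
    case False
    then obtain \<alpha> where \<alpha>: "f J = Fin \<alpha>" by (cases "f J") (auto simp: zero_zmax_def)
    show ?thesis
    proof (cases "p = q")
      case True
      then have "\<forall>j\<ge>J. f (Suc j) + g (Suc j) = p * (f j + g j)"
        by (simp add: f g distrib_left)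
      then show ?thesis unfolding ult_geometric_def eventually_sequentially by blast
    next
      case False
      show ?thesis
      proof (cases "q = 0 \<or> g J = 0")
        case True
        \<comment> \<open>If \<open>q = 0\<close>, then \<open>g J\<close> itself may be nonzero, so
          vanishing starts only at \<open>Suc J\<close>.\<close>
        then have "g j = 0" if "j \<ge> Suc J" for j using gk[of "j - J"] that by (auto simp: power_0_left)
        then show ?thesis by (intro f_ev exI[of _ "Suc J"]) simp
      next
        case False
        then obtain b \<beta> where b: "q = Fin b" "g J = Fin \<beta>"
          by (cases q; cases "g J") (auto simp: zero_zmax_def)
        with \<open>q \<le> p\<close> \<open>p \<noteq> q\<close> obtain a where a: "p = Fin a" "b < a" by (cases p) auto
        \<comment> \<open>Integer slopes differ by at least 1, so the initial gap
          \<open>\<beta> - \<alpha>\<close> is closed after that many steps.\<close>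
        have "f j + g j = f j" if j: "j \<ge> J + nat (\<beta> - \<alpha>)" for j
        proof -
          define k where "k = j - J"
          have k: "j = J + k" "\<beta> - \<alpha> \<le> int k" using j by (auto simp: k_def)
          have "int k * 1 \<le> int k * (a - b)" by (rule mult_left_mono) (use a in auto)
          then have "int k * b + \<beta> \<le> int k * a + \<alpha>"
            using k by (simp add: algebra_simps)
          then have "g j \<le> f j" by (simp add: k fk gk \<alpha> b a zmax_Fin_power)
          then show ?thesis by (simp add: plus_zmax_def)
        qed
        then show ?thesis by (intro f_ev) blast
      qed
    qed
  qed
qed

lemma ult_geometric_add:
  fixes f g :: "nat \<Rightarrow> zmax"
  assumes "ult_geometric f" "ult_geometric g"
  shows "ult_geometric (\<lambda>j. f j + g j)"
proof -
  obtain p q where "\<forall>\<^sub>F j in sequentially. f (Suc j) = p * f j"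
    "\<forall>\<^sub>F j in sequentially. g (Suc j) = q * g j"
    using assms unfolding ult_geometric_def by blast
  then have "\<forall>\<^sub>F j in sequentially. f (Suc j) = p * f j \<and> g (Suc j) = q * g j"
    by (rule eventually_conj)
  then obtain J where J: "\<And>j. j \<ge> J \<Longrightarrow> f (Suc j) = p * f j" "\<And>j. j \<ge> J \<Longrightarrow> g (Suc j) = q * g j"
    unfolding eventually_sequentially by blast
  show ?thesis
    using ult_geometric_add_dominant[of J f p g q] ult_geometric_add_dominant[of J g q f p] J
    by (cases "q \<le> p") (auto simp: add.commute)
qed

lemma periodically_geometric_mult:
  assumes "periodically_geometric N f" "M > 0"
  shows "periodically_geometric (N * M) f"
  using assms ult_geometric_subseq[OF _ assms(2), of "\<lambda>j. f (_ + N * j)"]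
  unfolding periodically_geometric_def by (auto simp: mult.assoc)

lemma periodically_geometric_add:
  fixes f g :: "nat \<Rightarrow> zmax"
  assumes "periodically_geometric N f" "periodically_geometric N g"
  shows "periodically_geometric N (\<lambda>n. f n + g n)"
  using assms ult_geometric_add unfolding periodically_geometric_def by blast

text \<open>Past index \<open>m\<close>, the coefficients on a residue class modulo \<open>c\<close>
  are either all zero or gain a factor \<open>q\<close> at each step.\<close>

lemma periodically_geometric_single:
  fixes a q :: "'a::comm_semiring_1"
  assumes "c > 0"
  shows "periodically_geometric c (fps_nth (fps_monom m a * fps_geo c q))"
  unfolding periodically_geometric_def
proof (intro conjI allI)
  fix r
  have "(fps_monom m a * fps_geo c q) $ (r + c * Suc j) = q * (fps_monom m a * fps_geo c q) $ (r + c * j)"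
    if "j \<ge> m" for j
  proof -
    define n where "n = r + c * j - m"
    have "m \<le> c * j" using that assms
      by (metis One_nat_def Suc_leI le_trans mult_le_mono1 nat_mult_1)
    then have "m \<le> r + c * j" "r + c * Suc j - m = n + c" by (auto simp: n_def)
    then show ?thesis
      using assms by (auto simp: fps_monom_mult_nth fps_geo_def n_def[symmetric] ac_simps)
  qed
  then show "ult_geometric (\<lambda>j. (fps_monom m a * fps_geo c q) $ (r + c * j))"
    unfolding ult_geometric_def eventually_sequentially by blast
qed (fact assms)

lemma rational_series_periodically_geometric:
  assumes "rational_series x"
  shows "\<exists>N. periodically_geometric N (fps_nth x)"
  using assms
proof induction
  case (single c m a q)
  then show ?case using periodically_geometric_single by blast
next
  case (add x y)
  then obtain N M where N: "periodically_geometric N (fps_nth x)"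
    and M: "periodically_geometric M (fps_nth y)" by blast
  then have "N > 0" "M > 0" by (auto simp: periodically_geometric_def)
  then have "periodically_geometric (N * M) (fps_nth x)" "periodically_geometric (N * M) (fps_nth y)"
    using periodically_geometric_mult[OF N, of M] periodically_geometric_mult[OF M, of N]
    by (auto simp: mult.commute[of M])
  then have "periodically_geometric (N * M) (\<lambda>n. x $ n + y $ n)"
    by (rule periodically_geometric_add)
  then show ?case by auto
qed

unbundle vec_syntax

section \<open>Coordinates of matrix orbits\<close>

lemma matrix_orbit_periodically_geometric:
  fixes A :: "zmax ^ 'n ^ 'n"
  shows "\<exists>N. periodically_geometric N (\<lambda>k. (((*v) A ^^ k) b) $ i)"
proof -
  define x where "x i = Abs_fps (\<lambda>k. (((*v) A ^^ k) b) $ i)" for i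
  have eq: "x i = fps_monom 0 (b $ i) + (\<Sum>j\<in>UNIV. fps_monom 1 (A $ i $ j) * x j)" for i
  proof (rule fps_ext)
    fix n show "x i $ n = (fps_monom 0 (b $ i) + (\<Sum>j\<in>UNIV. fps_monom 1 (A $ i $ j) * x j)) $ n"
      by (cases n) (simp_all add: x_def fps_monom_mult_nth fps_sum_nth matrix_vector_mult_def,
          simp_all add: fps_monom_def)
  qed
  \<comment> \<open>The system coefficients are monomials of degree 1, hence have no constant
    term.\<close>
  have "\<forall>i\<in>UNIV. rational_series (x i)"
    by (rule rational_series_system[OF _ _ _ eq])
      (auto simp: fps_monom_nth_0 intro: rational_series_monom)
  then obtain N where "periodically_geometric N (fps_nth (x i))"
    using rational_series_periodically_geometric by blast
  moreover have "fps_nth (x i) = (\<lambda>k. (((*v) A ^^ k) b) $ i)"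
    by (simp add: x_def fun_eq_iff)
  ultimately show ?thesis by metis
qed

unbundle no fps_syntax

text \<open>The product of the finitely many coordinate periods serves.\<close>

lemma common_period:
  fixes v :: "nat \<Rightarrow> 'a::comm_semiring_1 ^ 'n"
  assumes "\<And>i. \<exists>N. periodically_geometric N (\<lambda>k. v k $ i)"
  shows "\<exists>N. \<forall>i. periodically_geometric N (\<lambda>k. v k $ i)"
proof -
  obtain P where P: "\<And>i. periodically_geometric (P i) (\<lambda>k. v k $ i)"
    using assms by metis
  then have pos: "P i > 0" for i by (auto simp: periodically_geometric_def)
  have "prod P UNIV = P i * prod P (UNIV - {i})" for i by (simp add: prod.remove)
  then have "periodically_geometric (prod P UNIV) (\<lambda>k. v k $ i)" for i
    using periodically_geometric_mult[OF P, of "prod P (UNIV - {i})" i] pos by (simp add: prod_pos)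
  then show ?thesis by blast
qed

section \<open>Rationality of orbits\<close>

lemma rational_subset_UN:
  "finite I \<Longrightarrow> (\<And>i. i \<in> I \<Longrightarrow> rational_subset (S i)) \<Longrightarrow> rational_subset (\<Union>i\<in>I. S i)"
  by (induction I rule: finite_induct) (auto intro: rational_subset.finite rational_subset.union)

lemma singleton_set_power: "{g :: 'm::monoid_mult} ^ k = {g ^ k}"
  by (induction k) (auto simp: set_times_def)

text \<open>The general monoid allows vectors under the componentwise product, with a vector
  \<open>g\<close> of ratios, one for each coordinate.\<close>

lemma rational_subset_ult_geometric:
  fixes v :: "nat \<Rightarrow> 'm::comm_monoid_mult"
  assumes "\<And>j. j \<ge> J \<Longrightarrow> v (Suc j) = g * v j"
  shows "rational_subset (range v)"
proof -
  have vk: "v (J + k) = v J * g ^ k" for k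
    by (induction k) (auto simp: assms ac_simps)
  have "range v = v ` {..<J} \<union> {v J} * (\<Union>k. {g} ^ k)"
  proof -
    have "v j \<in> v ` {..<J} \<union> {v J} * (\<Union>k. {g} ^ k)" for j
      using vk[of "j - J"] by (cases "j < J") (auto simp: singleton_set_power set_times_def)
    then show ?thesis
      by (auto simp: singleton_set_power set_times_def simp flip: vk)
  qed
  then show ?thesis
    by (auto intro: rational_subset.intros)
qed

lemma rational_subset_periodically_geometric:
  fixes v :: "nat \<Rightarrow> 'a::comm_semiring_1 ^ 'n"
  assumes "\<And>i. periodically_geometric N (\<lambda>k. v k $ i)"
  shows "rational_subset (range v)"
proof -
  have N: "N > 0" using assms by (auto simp: periodically_geometric_def)
  have "rational_subset (range (\<lambda>j. v (r + N * j)))" for r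
  proof -
    have "\<exists>h. \<forall>\<^sub>F j in sequentially. v (r + N * Suc j) $ i = h * v (r + N * j) $ i" for i
      using assms[of i] by (auto simp: periodically_geometric_def ult_geometric_def)
    then obtain h where "\<And>i. \<forall>\<^sub>F j in sequentially. v (r + N * Suc j) $ i = h i * v (r + N * j) $ i"
      by metis
    \<comment> \<open>Finitely many coordinates share one threshold.\<close>
    then have "\<forall>\<^sub>F j in sequentially. \<forall>i. v (r + N * Suc j) $ i = h i * v (r + N * j) $ i"
      by (simp add: eventually_all_finite)
    then obtain J where "\<And>j. j \<ge> J \<Longrightarrow> v (r + N * Suc j) = (\<chi> i. h i) * v (r + N * j)"
      unfolding eventually_sequentially by (auto simp: vec_eq_iff)
    then show ?thesis by (rule rational_subset_ult_geometric)
  qed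
  moreover have "range v = (\<Union>r\<in>{..<N}. range (\<lambda>j. v (r + N * j)))"
  proof -
    have "v k \<in> range (\<lambda>j. v (k mod N + N * j))" for k
      by (metis mod_mult_div_eq rangeI)
    moreover have "k mod N < N" for k using N by simp
    ultimately show ?thesis by blast
  qed
  ultimately show ?thesis by (auto intro!: rational_subset_UN)
qed

text \<open>Reduces the generators of the reachable space to orbits of the columns of
  \<open>B\<close>.\<close>

lemma column_matrix_power_mult:
  fixes A :: "'a::semiring_1 ^ 'n ^ 'n"
  shows "column j (((**) A ^^ k) B) = ((*v) A ^^ k) (column j B)"
proof (induction k)
  case (Suc k)
  have "column j (A ** M) = A *v column j M" for M
    by (simp add: vec_eq_iff column_def matrix_matrix_mult_def matrix_vector_mult_def)
  then show ?case by (simp add: Suc)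
qed simp

theorem theorem4p1:
  fixes A :: "zmax ^ 'n ^ 'n" and B :: "zmax ^ 'p ^ 'n"
  shows "rational_semimodule (reachable_space A B)"
proof -
  have "(\<Union>k. columns (((**) A ^^ k) B)) = (\<Union>j\<in>UNIV. range (\<lambda>k. ((*v) A ^^ k) (column j B)))"
    unfolding columns_def column_matrix_power_mult by auto
  moreover have "rational_subset (range (\<lambda>k. ((*v) A ^^ k) b))" for b
  proof -
    obtain N where "\<And>i. periodically_geometric N (\<lambda>k. (((*v) A ^^ k) b) $ i)"
      using common_period[OF matrix_orbit_periodically_geometric] by blast
    then show ?thesis by (rule rational_subset_periodically_geometric)
  qed
  ultimately have "rational_subset (\<Union>k. columns (((**) A ^^ k) B))"
    by (auto intro!: rational_subset_UN)
  then show ?thesis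
    unfolding rational_semimodule_def reachable_space_def by blast
qed

end
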